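(* Let $\epsilon\in\{1,-1\}$, let $g_0$ be a constant real symmetric invertible $2\times2$ matrix, and let $\phi=\phi(x^1,x^2)$ be a smooth real function on an open set $U\subseteq\mathbb{R}^2$ with $\rho>0$ on $U$, whose graph $S_0$ is minimal, i.e. $H=0$. Let $g=h/\sqrt{\rho}$. Then the $2\times 2$ matrix-valued function $g=(g_{\alpha\beta})$ satisfies the sigma model equation $$\partial_\alpha\left[g^{\alpha\beta}\,g^{-1}\,\partial_\beta g\right]=0.$$
   Context: Greek indices run over $1,2$, repeated indices are summed, commas denote partial derivatives with respect to $x^1,x^2$, and $g_0^{\mu\nu}$ are the entries of $g_0^{-1}$. The graph $S_0=\{x^3=\phi(x^1,x^2)\}$ lies in the flat manifold $M_3$ with metric $g_{0\,\mu\nu}dx^\mu dx^\nu+\epsilon(dx^3)^2$; its induced metric is $h_{\mu\nu}=g_{0\,\mu\nu}+\epsilon\,\phi_{,\mu}\phi_{,\nu}$, with inverse $h^{\mu\nu}$. Put $\rho=1+\epsilon\,g_0^{\mu\nu}\phi_{,\mu}\phi_{,\nu}$, so $\det h=\rho\det g_0$. The mean curvature is $H=\rho^{-1/2}h^{\mu\nu}\phi_{,\mu\nu}$. The conformal metric is $g_{\alpha\beta}=h_{\alpha\beta}/\sqrt{\rho}$, with $\det g=\det g_0$. In the sigma model equation, $g^{\alpha\beta}$ are the scalar components of the inverse metric, while $g^{-1}\partial_\beta g$ is the product of $2\times2$ matrices. *)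

theory Defs
  imports "HOL-Analysis.Analysis"
begin

definition partial :: "'n \<Rightarrow> (real ^ 'n \<Rightarrow> 'b::real_normed_vector) \<Rightarrow> real ^ 'n \<Rightarrow> 'b"
  where "partial i f x = vector_derivative (\<lambda>t. f (x + t *\<^sub>R axis i 1)) (at 0)"

text \<open>Class \<open>C\<^sup>k\<close> on an open set. Differentiability at each stage ensures that the values of
  \<^const>\<open>partial\<close> are genuine partial derivatives.\<close>

primrec Ck_on :: "nat \<Rightarrow> (real ^ 'n) set \<Rightarrow> (real ^ 'n \<Rightarrow> 'b::real_normed_vector) \<Rightarrow> bool"
  where
    "Ck_on 0 U f \<longleftrightarrow> continuous_on U f"
  | "Ck_on (Suc k) U f \<longleftrightarrow> f differentiable_on U \<and> (\<forall>i. Ck_on k U (partial i f))"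

definition smooth_on :: "(real ^ 'n) set \<Rightarrow> (real ^ 'n \<Rightarrow> 'b::real_normed_vector) \<Rightarrow> bool"
  where "smooth_on U f \<longleftrightarrow> (\<forall>k. Ck_on k U f)"

text \<open>Below, \<open>e\<close> is the sign \<open>\<epsilon>\<close> of the ambient metric
  \<open>g\<^sub>0\<^sub>\<mu>\<^sub>\<nu> dx\<^sup>\<mu> dx\<^sup>\<nu> + \<epsilon> (dx\<^sup>3)\<^sup>2\<close>, \<open>g0\<close> the constant matrix \<open>g\<^sub>0\<close>, and \<open>\<phi>\<close> the height
  function of the graph. The metric on the graph is expressed in the coordinates \<open>x\<^sup>1, x\<^sup>2\<close>.\<close>

definition induced_metric ::
    "real \<Rightarrow> real ^ 2 ^ 2 \<Rightarrow> (real ^ 2 \<Rightarrow> real) \<Rightarrow> real ^ 2 \<Rightarrow> real ^ 2 ^ 2"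
  where "induced_metric e g0 \<phi> x =
    (\<chi> \<mu> \<nu>. g0 $ \<mu> $ \<nu> + e * partial \<mu> \<phi> x * partial \<nu> \<phi> x)"

definition rho :: "real \<Rightarrow> real ^ 2 ^ 2 \<Rightarrow> (real ^ 2 \<Rightarrow> real) \<Rightarrow> real ^ 2 \<Rightarrow> real"
  where "rho e g0 \<phi> x =
    1 + e * (\<Sum>\<mu>\<in>UNIV. \<Sum>\<nu>\<in>UNIV. matrix_inv g0 $ \<mu> $ \<nu> * partial \<mu> \<phi> x * partial \<nu> \<phi> x)"

definition mean_curvature ::
    "real \<Rightarrow> real ^ 2 ^ 2 \<Rightarrow> (real ^ 2 \<Rightarrow> real) \<Rightarrow> real ^ 2 \<Rightarrow> real"
  where "mean_curvature e g0 \<phi> x =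
    rho e g0 \<phi> x powr (- 1 / 2) *
      (\<Sum>\<mu>\<in>UNIV. \<Sum>\<nu>\<in>UNIV.
        matrix_inv (induced_metric e g0 \<phi> x) $ \<mu> $ \<nu> * partial \<nu> (partial \<mu> \<phi>) x)"

definition conformal_metric ::
    "real \<Rightarrow> real ^ 2 ^ 2 \<Rightarrow> (real ^ 2 \<Rightarrow> real) \<Rightarrow> real ^ 2 \<Rightarrow> real ^ 2 ^ 2"
  where "conformal_metric e g0 \<phi> x =
    (\<chi> \<alpha> \<beta>. induced_metric e g0 \<phi> x $ \<alpha> $ \<beta> / sqrt (rho e g0 \<phi> x))"

text \<open>In the current, \<open>g\<close> plays two roles: the entries \<open>g\<^sup>\<alpha>\<^sup>\<beta>\<close> of its inverse are scalar
  coefficients, whereas \<open>g\<^sup>-\<^sup>1 \<partial>\<^sub>\<beta> g\<close> is a product of matrices.\<close>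

definition sigma_current ::
    "(real ^ 2 \<Rightarrow> real ^ 2 ^ 2) \<Rightarrow> 2 \<Rightarrow> real ^ 2 \<Rightarrow> real ^ 2 ^ 2"
  where "sigma_current g \<alpha> x =
    (\<Sum>\<beta>\<in>UNIV. (matrix_inv (g x) $ \<alpha> $ \<beta>) *\<^sub>R (matrix_inv (g x) ** partial \<beta> g x))"

text \<open>Since \<^const>\<open>vector_derivative\<close> is total, being a solution includes the existence of the
  derivatives that occur in the equation.\<close>

definition sigma_model_on :: "(real ^ 2) set \<Rightarrow> (real ^ 2 \<Rightarrow> real ^ 2 ^ 2) \<Rightarrow> bool"
  where "sigma_model_on U g \<longleftrightarrow>
    g differentiable_on U \<and> (\<forall>\<alpha>. sigma_current g \<alpha> differentiable_on U) \<and>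
    (\<forall>x\<in>U. (\<Sum>\<alpha>\<in>UNIV. partial \<alpha> (sigma_current g \<alpha>) x) = 0)"

end

theory Submission
  imports Defs
begin

text \<open>
  Minimality makes the coordinates \<open>x\<^sup>1, x\<^sup>2\<close> harmonic for the induced metric. Since
  \<open>sqrt \<bar>det h\<bar> h\<^sup>\<alpha>\<^sup>\<beta> = sqrt \<bar>det g\<^sub>0\<bar> g\<^sup>\<alpha>\<^sup>\<beta>\<close>, this says that the inverse of the conformal metric is
  divergence free, \<open>\<partial>\<^sub>\<alpha> g\<^sup>\<alpha>\<^sup>\<beta> = 0\<close>. In two dimensions \<open>g\<^sup>-\<^sup>1\<close> is, up to the constant factor
  \<open>1 / det g\<^sub>0\<close>, a rearrangement of the entries of \<open>g\<close> with signs, and the same condition becomes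
  \<open>\<partial>\<^sub>\<alpha> g\<^sub>\<beta>\<^sub>\<gamma> = \<partial>\<^sub>\<beta> g\<^sub>\<alpha>\<^sub>\<gamma>\<close>: locally \<open>g\<close> is the Hessian of a function whose Monge-Ampere determinant is
  constant. This form is proved directly in \<open>minimal_conformal_metric_Hessian\<close>.

  For such a \<open>g\<close> the sigma model equation is almost immediate. Differentiating the inverse gives
  \<open>\<partial>\<^sub>\<mu> g\<^sup>\<alpha>\<^sup>\<lambda> = - g\<^sup>\<alpha>\<^sup>\<beta> (\<partial>\<^sub>\<mu> g\<^sub>\<beta>\<^sub>\<nu>) g\<^sup>\<nu>\<^sup>\<lambda>\<close>, and because \<open>\<partial>\<^sub>\<mu> g\<^sub>\<beta>\<^sub>\<nu>\<close> may be replaced by \<open>\<partial>\<^sub>\<beta> g\<^sub>\<nu>\<^sub>\<mu>\<close>, the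
  right-hand side is minus the \<open>(\<lambda>, \<mu>)\<close> entry of the current \<open>g\<^sup>\<alpha>\<^sup>\<beta> g\<^sup>-\<^sup>1 \<partial>\<^sub>\<beta> g\<close>. The divergence of the
  current is therefore \<open>- \<partial>\<^sub>\<alpha> \<partial>\<^sub>\<mu> g\<^sup>\<alpha>\<^sup>\<lambda> = - \<partial>\<^sub>\<mu> (\<partial>\<^sub>\<alpha> g\<^sup>\<alpha>\<^sup>\<lambda>) = 0\<close>
  (\<open>unimodular_Hessian_metric_sigma_model\<close>). The exchange of derivatives is Schwarz's theorem,
  \<open>partial_commute\<close>; it also supplies the symmetry of the second derivatives of \<open>\<phi>\<close>.
\<close>

section \<open>Calculus of partial derivatives\<close>

text \<open>Through this rule the calculus of Frechet derivatives carries over to \<^const>\<open>partial\<close>.\<close>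

lemma partial_eq:
  assumes "(f has_derivative D) (at x)"
  shows "partial i f x = D (axis i 1)"
proof -
  interpret D: bounded_linear D using assms by (rule has_derivative_bounded_linear)
  have "((\<lambda>t::real. x + t *\<^sub>R axis i 1) has_derivative (\<lambda>t. t *\<^sub>R axis i 1)) (at 0)"
    by (auto intro!: derivative_eq_intros)
  from has_derivative_compose[OF this, of f D] assms
  have "((\<lambda>t. f (x + t *\<^sub>R axis i 1)) has_derivative (\<lambda>t. D (t *\<^sub>R axis i 1))) (at 0)"
    by simp
  then have "((\<lambda>t. f (x + t *\<^sub>R axis i 1)) has_vector_derivative D (axis i 1)) (at 0)"
    by (simp add: has_vector_derivative_def D.scaleR)
  then show ?thesis
    unfolding partial_def by (rule vector_derivative_at)
qed

lemma has_real_derivative_along_axis: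
  fixes f :: "real ^ 'n \<Rightarrow> real"
  assumes "f differentiable at (y + t *\<^sub>R axis i 1)"
  shows "((\<lambda>t. f (y + t *\<^sub>R axis i 1)) has_real_derivative partial i f (y + t *\<^sub>R axis i 1)) (at t)"
proof -
  obtain D where D: "(f has_derivative D) (at (y + t *\<^sub>R axis i 1))"
    using assms by (auto simp: differentiable_def)
  interpret D: bounded_linear D using D by (rule has_derivative_bounded_linear)
  have "((\<lambda>t::real. y + t *\<^sub>R axis i 1) has_derivative (\<lambda>t. t *\<^sub>R axis i 1)) (at t)"
    by (auto intro!: derivative_eq_intros)
  from has_derivative_compose[OF this D]
  show ?thesis
    by (simp add: has_field_derivative_def D.scaleR partial_eq[OF D] mult_commute_abs)
qed

text \<open>A partial derivative depends on the germ of the function only, so an identity that holds on an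
  open set may be differentiated there.\<close>

lemma partial_cong_on_open:
  assumes "open U" "x \<in> U" "\<And>y. y \<in> U \<Longrightarrow> f y = g y"
  shows "partial i f x = partial i g x"
proof -
  let ?l = "\<lambda>t::real. x + t *\<^sub>R axis i 1"
  have "open (?l -` U)" using assms(1) by (intro open_vimage continuous_intros)
  then have "\<forall>\<^sub>F t in nhds 0. t \<in> ?l -` U" using assms(2) by (intro eventually_nhds_in_open) auto
  then have "\<forall>\<^sub>F t in nhds 0. ?l t \<in> U" by simp
  then have "\<forall>\<^sub>F t in nhds 0. t \<in> UNIV \<longrightarrow> f (?l t) = g (?l t)"
    by (rule eventually_mono) (simp add: assms(3))
  then show ?thesis
    unfolding partial_def by (rule vector_derivative_cong_eq) simp_all
qed

lemma partial_const [simp]: "partial i (\<lambda>x. c) = (\<lambda>x. 0)"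
  by (rule ext) (rule partial_eq[OF has_derivative_const])

lemma partial_add:
  assumes "f differentiable at x" "g differentiable at x"
  shows "partial i (\<lambda>x. f x + g x) x = partial i f x + partial i g x"
proof -
  obtain D E where D: "(f has_derivative D) (at x)" and E: "(g has_derivative E) (at x)"
    using assms unfolding differentiable_def by blast
  show ?thesis
    using partial_eq[OF has_derivative_add[OF D E], of i] partial_eq[OF D] partial_eq[OF E] by simp
qed

lemma partial_uminus:
  assumes "f differentiable at x"
  shows "partial i (\<lambda>x. - f x) x = - partial i f x"
proof -
  obtain D where D: "(f has_derivative D) (at x)" using assms unfolding differentiable_def by blast
  show ?thesis using partial_eq[OF has_derivative_minus[OF D], of i] partial_eq[OF D] by simp
qed

lemma partial_mult:
  fixes f g :: "real ^ 'n \<Rightarrow> real"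
  assumes "f differentiable at x" "g differentiable at x"
  shows "partial i (\<lambda>x. f x * g x) x = f x * partial i g x + partial i f x * g x"
proof -
  obtain D E where D: "(f has_derivative D) (at x)" and E: "(g has_derivative E) (at x)"
    using assms unfolding differentiable_def by blast
  show ?thesis
    using partial_eq[OF has_derivative_mult[OF D E], of i] partial_eq[OF D] partial_eq[OF E] by simp
qed

lemma has_derivative_inverse_sqrt:
  fixes f :: "'a::real_normed_vector \<Rightarrow> real"
  assumes D: "(f has_derivative D) (at x)" and "f x > 0"
  shows "((\<lambda>x. inverse (sqrt (f x))) has_derivative
    (\<lambda>v. - D v * inverse (sqrt (f x)) ^ 3 / 2)) (at x)"
  using assms(2)
  by (auto intro!: derivative_eq_intros D simp: fun_eq_iff field_simps power3_eq_cube)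

lemma partial_inverse_sqrt:
  fixes f :: "real ^ 'n \<Rightarrow> real"
  assumes "f differentiable at x" "f x > 0"
  shows "partial i (\<lambda>x. inverse (sqrt (f x))) x = - partial i f x * inverse (sqrt (f x)) ^ 3 / 2"
proof -
  obtain D where D: "(f has_derivative D) (at x)" using assms unfolding differentiable_def by blast
  show ?thesis
    using partial_eq[OF has_derivative_inverse_sqrt[OF D assms(2)], of i] partial_eq[OF D] by simp
qed

lemma differentiable_vec:
  fixes f :: "'a::real_normed_vector \<Rightarrow> ('b::euclidean_space) ^ 'n"
  assumes "\<And>a. (\<lambda>x. f x $ a) differentiable F"
  shows "f differentiable F"
proof -
  have f_eq: "f = (\<lambda>x. \<Sum>a\<in>UNIV. axis a (f x $ a))"
    by (simp add: fun_eq_iff vec_eq_iff axis_def)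
  have "bounded_linear (axis a :: 'b \<Rightarrow> 'b ^ 'n)" for a
    by (intro linear_conv_bounded_linear[THEN iffD1] linearI) (simp_all add: axis_def vec_eq_iff)
  then have "(\<lambda>x. axis a (f x $ a)) differentiable F" for a
    using assms[of a] bounded_linear.has_derivative unfolding differentiable_def by blast
  then show ?thesis by (subst f_eq) (intro differentiable_sum, simp_all)
qed

lemma partial_vec_nth:
  fixes f :: "real ^ 'm \<Rightarrow> ('b::euclidean_space) ^ 'n"
  assumes "f differentiable at x"
  shows "partial i f x $ a = partial i (\<lambda>x. f x $ a) x"
proof -
  obtain D where D: "(f has_derivative D) (at x)" using assms unfolding differentiable_def by blast
  show ?thesis
    using partial_eq[OF bounded_linear.has_derivative[OF bounded_linear_vec_nth D], of i a]
      partial_eq[OF D] by simp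
qed

section \<open>Symmetry of second derivatives\<close>

text \<open>The mean value theorem is applied first in direction \<open>i\<close>, to the difference of \<open>f\<close> on two
  opposite sides of a square, and then in direction \<open>j\<close>. The left-hand side is symmetric in \<open>i\<close> and
  \<open>j\<close>, whereas the right-hand side shows the order of differentiation.\<close>

lemma second_difference_mean_value:
  fixes f :: "real ^ 'n \<Rightarrow> real"
  assumes "open U" "h > 0"
    and f: "f differentiable_on U" and fi: "partial i f differentiable_on U"
    and U: "\<And>s t. \<lbrakk>0 \<le> s; s \<le> h; 0 \<le> t; t \<le> h\<rbrakk> \<Longrightarrow> x + s *\<^sub>R axis i 1 + t *\<^sub>R axis j 1 \<in> U"
  shows "\<exists>s t. 0 \<le> s \<and> s \<le> h \<and> 0 \<le> t \<and> t \<le> h \<and>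
    f (x + h *\<^sub>R axis i 1 + h *\<^sub>R axis j 1) - f (x + h *\<^sub>R axis i 1) - f (x + h *\<^sub>R axis j 1) + f x
      = h\<^sup>2 * partial j (partial i f) (x + s *\<^sub>R axis i 1 + t *\<^sub>R axis j 1)"
proof -
  have at: "k differentiable at y" if "k differentiable_on U" "y \<in> U" for k :: "real ^ 'n \<Rightarrow> real" and y
    using that \<open>open U\<close> by (simp add: differentiable_on_eq_differentiable_at)
  let ?ei = "axis i 1 :: real ^ 'n" and ?ej = "axis j 1 :: real ^ 'n"
  let ?F = "\<lambda>s. f ((x + h *\<^sub>R ?ej) + s *\<^sub>R ?ei) - f (x + s *\<^sub>R ?ei)"
  have "DERIV ?F s :> partial i f ((x + h *\<^sub>R ?ej) + s *\<^sub>R ?ei) - partial i f (x + s *\<^sub>R ?ei)"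
    if "0 \<le> s" "s \<le> h" for s
    using U[OF that, of h] U[OF that, of 0] \<open>h > 0\<close>
    by (intro DERIV_diff has_real_derivative_along_axis at[OF f]) (simp_all add: algebra_simps)
  from MVT2[OF \<open>h > 0\<close> this] obtain s where s: "0 < s" "s < h"
    and Fs: "?F h - ?F 0 = h * (partial i f (x + h *\<^sub>R ?ej + s *\<^sub>R ?ei) - partial i f (x + s *\<^sub>R ?ei))"
    by auto
  let ?G = "\<lambda>t. partial i f ((x + s *\<^sub>R ?ei) + t *\<^sub>R ?ej)"
  have "DERIV ?G t :> partial j (partial i f) ((x + s *\<^sub>R ?ei) + t *\<^sub>R ?ej)"
    if "0 \<le> t" "t \<le> h" for t
    using U[of s t] that s by (intro has_real_derivative_along_axis at[OF fi]) simp
  from MVT2[OF \<open>h > 0\<close> this] obtain t where t: "0 < t" "t < h"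
    and Gt: "?G h - ?G 0 = h * partial j (partial i f) (x + s *\<^sub>R ?ei + t *\<^sub>R ?ej)"
    by auto
  have "?F h - ?F 0 = h * (?G h - ?G 0)"
    unfolding Fs by (simp add: add.commute add.left_commute)
  also have "\<dots> = h\<^sup>2 * partial j (partial i f) (x + s *\<^sub>R ?ei + t *\<^sub>R ?ej)"
    unfolding Gt by (simp add: power2_eq_square)
  finally show ?thesis
    using s t by (intro exI[of _ s] exI[of _ t]) (simp add: add.commute add.left_commute)
qed

text \<open>Schwarz's theorem. The second difference over a small square equals both mixed derivatives, at
  two points of that square; continuity of these derivatives leaves no gap between their values
  at the corner \<open>x\<close>.\<close>

lemma partial_commute:
  fixes f :: "real ^ 'n \<Rightarrow> real"
  assumes "open U" "x \<in> U" and f: "Ck_on 2 U f"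
  shows "partial i (partial j f) x = partial j (partial i f) x"
proof (rule ccontr)
  assume neq: "\<not> ?thesis"
  define \<delta> where "\<delta> = \<bar>partial i (partial j f) x - partial j (partial i f) x\<bar> / 2"
  have "\<delta> > 0" using neq by (simp add: \<delta>_def)
  have d: "f differentiable_on U" "partial k f differentiable_on U"
    "continuous_on U (partial l (partial k f))" for k l
    using f by (auto simp: numeral_2_eq_2)
  have near: "\<forall>\<^sub>F y in nhds x. \<bar>partial k (partial l f) y - partial k (partial l f) x\<bar> < \<delta>" for k l
  proof -
    have "continuous (at x) (partial k (partial l f))"
      using d(3) assms(1,2) by (simp add: continuous_on_eq_continuous_at)
    then have "(partial k (partial l f) \<longlongrightarrow> partial k (partial l f) x) (nhds x)"
      by (simp add: continuous_at tendsto_at_iff_tendsto_nhds)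
    from tendstoD[OF this \<open>\<delta> > 0\<close>] show ?thesis
      by (simp add: dist_real_def)
  qed
  have "\<forall>\<^sub>F y in nhds x. y \<in> U" using assms(1,2) by (intro eventually_nhds_in_open)
  from eventually_conj[OF this eventually_conj[OF near[of i j] near[of j i]]]
  obtain r where "r > 0" and r: "\<And>y. dist y x < r \<Longrightarrow> y \<in> U \<and>
      \<bar>partial i (partial j f) y - partial i (partial j f) x\<bar> < \<delta> \<and>
      \<bar>partial j (partial i f) y - partial j (partial i f) x\<bar> < \<delta>"
    unfolding eventually_nhds_metric by blast
  \<comment> \<open>A square of side \<open>r / 3\<close> lies in the ball of radius \<open>r\<close>, as its diameter is at most \<open>2 r / 3\<close>.\<close>
  define h where "h = r / 3"
  have "h > 0" using \<open>r > 0\<close> by (simp add: h_def)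
  have square: "dist (x + s *\<^sub>R axis k 1 + t *\<^sub>R axis l 1) x < r"
    if "0 \<le> s" "s \<le> h" "0 \<le> t" "t \<le> h" for s t k l
  proof -
    have "norm (s *\<^sub>R axis k 1 + t *\<^sub>R axis l 1 :: real ^ 'n) \<le> s + t"
      using that by (intro order_trans[OF norm_triangle_ineq]) simp
    also have "\<dots> < r" using that \<open>r > 0\<close> by (simp add: h_def)
    finally show ?thesis by (simp add: dist_norm algebra_simps)
  qed
  obtain s t where st: "0 \<le> s" "s \<le> h" "0 \<le> t" "t \<le> h" and
    1: "f (x + h *\<^sub>R axis i 1 + h *\<^sub>R axis j 1) - f (x + h *\<^sub>R axis i 1) - f (x + h *\<^sub>R axis j 1) + f x
      = h\<^sup>2 * partial j (partial i f) (x + s *\<^sub>R axis i 1 + t *\<^sub>R axis j 1)"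
    using second_difference_mean_value[OF \<open>open U\<close> \<open>h > 0\<close> d(1,2), of x i j] r square by metis
  obtain s' t' where st': "0 \<le> s'" "s' \<le> h" "0 \<le> t'" "t' \<le> h" and
    2: "f (x + h *\<^sub>R axis j 1 + h *\<^sub>R axis i 1) - f (x + h *\<^sub>R axis j 1) - f (x + h *\<^sub>R axis i 1) + f x
      = h\<^sup>2 * partial i (partial j f) (x + s' *\<^sub>R axis j 1 + t' *\<^sub>R axis i 1)"
    using second_difference_mean_value[OF \<open>open U\<close> \<open>h > 0\<close> d(1,2), of x j i] r square by metis
  have "x + h *\<^sub>R axis j 1 + h *\<^sub>R axis i 1 = x + h *\<^sub>R axis i 1 + h *\<^sub>R axis j (1::real)"
    by (simp add: algebra_simps)
  from 2[unfolded this] 1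
  have "h\<^sup>2 * partial j (partial i f) (x + s *\<^sub>R axis i 1 + t *\<^sub>R axis j 1)
      = h\<^sup>2 * partial i (partial j f) (x + s' *\<^sub>R axis j 1 + t' *\<^sub>R axis i 1)"
    by linarith
  then have "partial j (partial i f) (x + s *\<^sub>R axis i 1 + t *\<^sub>R axis j 1)
      = partial i (partial j f) (x + s' *\<^sub>R axis j 1 + t' *\<^sub>R axis i 1)"
    using \<open>h > 0\<close> by simp
  moreover have "\<bar>partial j (partial i f) (x + s *\<^sub>R axis i 1 + t *\<^sub>R axis j 1) - partial j (partial i f) x\<bar> < \<delta>"
    using r[OF square[OF st]] by blast
  moreover have "\<bar>partial i (partial j f) (x + s' *\<^sub>R axis j 1 + t' *\<^sub>R axis i 1) - partial i (partial j f) x\<bar> < \<delta>"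
    using r[OF square[OF st']] by blast
  ultimately have "\<bar>partial i (partial j f) x - partial j (partial i f) x\<bar> < \<delta> + \<delta>"
    by (simp only: abs_less_iff) linarith
  then show False by (simp add: \<delta>_def)
qed

section \<open>Closure properties of \<open>C\<^sup>k\<close> functions\<close>

lemma Ck_on_cong:
  assumes "open U" "Ck_on k U f" "\<And>x. x \<in> U \<Longrightarrow> f x = g x"
  shows "Ck_on k U g"
  using assms(2,3)
proof (induction k arbitrary: f g)
  case 0
  then show ?case using continuous_on_cong[of U U f g] by simp
next
  case (Suc k)
  have "Ck_on k U (partial i g)" for i
    using Suc.prems by (intro Suc.IH[of "partial i f" "partial i g"] partial_cong_on_open[OF \<open>open U\<close>]) simp_all
  moreover have "g differentiable_on U"
    using Suc.prems unfolding Ck_on.simps differentiable_on_def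
    by (metis differentiable_transform_within zero_less_one)
  ultimately show ?case by simp
qed

lemma Ck_on_SucD: "Ck_on (Suc k) U f \<Longrightarrow> Ck_on k U f"
  by (induction k arbitrary: f) (auto intro: differentiable_imp_continuous_on)

lemma Ck_on_const: "Ck_on k U (\<lambda>x. c)"
  by (induction k arbitrary: c) auto

context
  fixes U :: "(real ^ 'n) set"
  assumes open_U: "open U"
begin

lemma Ck_on_differentiable_at: "Ck_on (Suc k) U f \<Longrightarrow> x \<in> U \<Longrightarrow> f differentiable at x"
  using open_U by (auto simp: differentiable_on_eq_differentiable_at)

lemma Ck_on_add:
  "Ck_on k U f \<Longrightarrow> Ck_on k U g \<Longrightarrow> Ck_on k U (\<lambda>x. f x + g x)"
proof (induction k arbitrary: f g)
  case 0
  then show ?case by (simp add: continuous_on_add)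
next
  case (Suc k)
  note diff = Suc.prems[THEN Ck_on_differentiable_at]
  have "Ck_on k U (partial i (\<lambda>x. f x + g x))" for i
    by (rule Ck_on_cong[OF open_U Suc.IH[of "partial i f" "partial i g"]])
      (use Suc.prems in \<open>simp_all add: partial_add diff\<close>)
  then show ?case using Suc.prems by (auto intro: differentiable_on_add)
qed

lemma Ck_on_mult:
  fixes f g :: "real ^ 'n \<Rightarrow> real"
  shows "Ck_on k U f \<Longrightarrow> Ck_on k U g \<Longrightarrow> Ck_on k U (\<lambda>x. f x * g x)"
proof (induction k arbitrary: f g)
  case 0
  then show ?case by (simp add: continuous_on_mult)
next
  case (Suc k)
  note diff = Suc.prems[THEN Ck_on_differentiable_at] and lower = Suc.prems[THEN Ck_on_SucD]
  have "Ck_on k U (partial i (\<lambda>x. f x * g x))" for i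
    by (rule Ck_on_cong[OF open_U Ck_on_add[OF Suc.IH[of f "partial i g"] Suc.IH[of "partial i f" g]]])
      (use Suc.prems in \<open>simp_all add: partial_mult diff lower\<close>)
  then show ?case using Suc.prems by (auto intro: differentiable_on_mult)
qed

text \<open>The partial derivatives of \<open>w = f\<^sup>-\<^sup>1\<^sup>/\<^sup>2\<close> are \<open>- f\<^sub>i w\<^sup>3 / 2\<close>, products in which \<open>w\<close> occurs only
  undifferentiated, so that induction on the order applies.\<close>

lemma Ck_on_inverse_sqrt:
  fixes f :: "real ^ 'n \<Rightarrow> real"
  assumes pos: "\<And>x. x \<in> U \<Longrightarrow> f x > 0"
  shows "Ck_on k U f \<Longrightarrow> Ck_on k U (\<lambda>x. inverse (sqrt (f x)))"
proof (induction k)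
  case 0
  then show ?case using pos by (simp add: continuous_on_inverse continuous_on_real_sqrt less_imp_neq[symmetric])
next
  case (Suc k)
  let ?w = "\<lambda>x. inverse (sqrt (f x))"
  have w: "Ck_on k U ?w" using Suc by (blast dest: Ck_on_SucD)
  have "Ck_on k U (partial i ?w)" for i
  proof (rule Ck_on_cong[OF open_U])
    show "Ck_on k U (\<lambda>x. (- 1 / 2) * (partial i f x * (?w x * (?w x * ?w x))))"
      using Suc.prems by (intro Ck_on_mult Ck_on_const w) simp
  qed (simp add: partial_inverse_sqrt Ck_on_differentiable_at[OF Suc.prems] pos power3_eq_cube)
  moreover have "?w differentiable_on U"
    unfolding differentiable_on_eq_differentiable_at[OF open_U]
  proof
    fix x assume x: "x \<in> U"
    then obtain D where "(f has_derivative D) (at x)"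
      using Ck_on_differentiable_at[OF Suc.prems] by (auto simp: differentiable_def)
    from has_derivative_inverse_sqrt[OF this pos[OF x]] show "?w differentiable at x"
      by (rule differentiableI)
  qed
  ultimately show ?case by simp
qed

end


section \<open>Two by two matrices\<close>

definition cofactor :: "real ^ 2 ^ 2 \<Rightarrow> real ^ 2 ^ 2"
  where "cofactor A = vector [vector [A $ 2 $ 2, - A $ 2 $ 1], vector [- A $ 1 $ 2, A $ 1 $ 1]]"

lemma cofactor_nth [simp]:
  "cofactor A $ 1 $ 1 = A $ 2 $ 2" "cofactor A $ 1 $ 2 = - A $ 2 $ 1"
  "cofactor A $ 2 $ 1 = - A $ 1 $ 2" "cofactor A $ 2 $ 2 = A $ 1 $ 1"
  by (simp_all add: cofactor_def)

lemma matrix_inv_mult: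
  fixes A :: "real ^ 'n ^ 'n"
  assumes "det A \<noteq> 0"
  shows "matrix_inv A ** A = mat 1" "A ** matrix_inv A = mat 1"
proof -
  have "\<exists>B. A ** B = mat 1 \<and> B ** A = mat 1"
    using assms by (simp add: invertible_def flip: invertible_det_nz)
  from someI_ex[OF this] show "matrix_inv A ** A = mat 1" "A ** matrix_inv A = mat 1"
    by (simp_all add: matrix_inv_def)
qed

lemma matrix_inv_2:
  fixes A :: "real ^ 2 ^ 2"
  assumes "det A \<noteq> 0"
  shows "matrix_inv A $ i $ j = cofactor A $ j $ i / det A"
proof -
  define B where "B = (\<chi> i j. cofactor A $ j $ i / det A)"
  have "A ** B = mat 1"
    using assms exhaust_2
    by (simp add: vec_eq_iff matrix_matrix_mult_def mat_def B_def sum_2 forall_2 field_simps)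
      (simp add: det_2 algebra_simps)
  then have "matrix_inv A = (matrix_inv A ** A) ** B"
    by (simp flip: matrix_mul_assoc)
  then show ?thesis by (simp add: matrix_inv_mult[OF assms] B_def)
qed

section \<open>Hessian metrics of constant determinant solve the sigma model equation\<close>

text \<open>The total symmetry of \<open>\<partial>\<^sub>a g\<^sub>b\<^sub>c\<close> is used twice: it turns the current into a derivative of the
  inverse metric, and, together with the constant determinant, it makes the inverse metric
  divergence free.\<close>

lemma unimodular_Hessian_metric_sigma_model:
  fixes g :: "real ^ 2 \<Rightarrow> real ^ 2 ^ 2"
  assumes U: "open U" and C2: "\<And>a b. Ck_on 2 U (\<lambda>x. g x $ a $ b)"
    and sym: "\<And>x a b. g x $ a $ b = g x $ b $ a"
    and det: "\<And>x. x \<in> U \<Longrightarrow> det (g x) = d" and "d \<noteq> 0"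
    and Hess: "\<And>x a b c. x \<in> U \<Longrightarrow>
      partial a (\<lambda>x. g x $ b $ c) x = partial b (\<lambda>x. g x $ a $ c) x"
  shows "sigma_model_on U g"
proof -
  define G where "G a b = (\<lambda>x. g x $ a $ b)" for a b
  \<comment> \<open>\<open>K\<close> is the inverse metric on \<open>U\<close>. Dividing by the constant \<open>d\<close> instead of \<open>det (g x)\<close> makes its
    entries constant multiples of those of \<open>g\<close> at every point.\<close>
  define K where "K a b = (\<lambda>x. cofactor (g x) $ a $ b * (1 / d))" for a b
  have G: "Ck_on 2 U (G a b)" for a b using C2 by (simp add: G_def)
  have G_sym: "G a b = G b a" for a b using sym by (auto simp: G_def)
  have K_eq: "K 1 1 = (\<lambda>x. G 2 2 x * (1 / d))" "K 1 2 = (\<lambda>x. G 1 2 x * (- 1 / d))"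
    "K 2 1 = (\<lambda>x. G 1 2 x * (- 1 / d))" "K 2 2 = (\<lambda>x. G 1 1 x * (1 / d))"
    using sym by (auto simp: K_def G_def)
  have K_sym: "K a b = K b a" for a b
    using exhaust_2[of a] exhaust_2[of b] by (auto simp: K_eq)
  have K: "Ck_on 2 U (K a b)" for a b
    using exhaust_2[of a] exhaust_2[of b]
    by (elim disjE) (simp_all only: K_eq Ck_on_mult[OF U G Ck_on_const])
  have inv: "matrix_inv (g x) $ a $ b = K a b x" if "x \<in> U" for a b x
    using matrix_inv_2[of "g x" a b] det[OF that] \<open>d \<noteq> 0\<close> K_sym[of a b] by (simp add: K_def fun_eq_iff)
  have diff: "f differentiable at x" "partial i f differentiable at x"
    if "Ck_on 2 U f" "x \<in> U" for f :: "real ^ 2 \<Rightarrow> real" and x i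
    using that U by (auto simp: numeral_2_eq_2 differentiable_on_eq_differentiable_at)
  note diff_K = diff[OF K] and diff_G = diff[OF G]

  have Hess': "partial a (G b c) x = partial b (G a c) x" if "x \<in> U" for a b c x
    using Hess[OF that] by (simp add: G_def)

  have div_K: "(\<Sum>a\<in>UNIV. partial a (K a b) x) = 0" if "x \<in> U" for b x
  proof -
    have G_scaled: "partial i (\<lambda>x. G k l x * c) x = partial i (G k l) x * c" for i k l c
      using partial_mult[OF diff_G(1)[OF that] differentiable_const] by simp
    show ?thesis
      using exhaust_2[of b]
    proof
      assume b: "b = 1"
      show ?thesis
        unfolding b sum_2 K_eq G_scaled using Hess'[OF that, of 1 2 2] by simp
    next
      assume b: "b = 2"
      show ?thesis
        unfolding b sum_2 K_eq G_scaled using Hess'[OF that, of 1 2 1] G_sym[of 2 1] by simp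
    qed
  qed

  have inverse: "(\<Sum>n\<in>UNIV. K l n x * G n m x) = (if l = m then 1 else 0)" if "x \<in> U" for l m x
    using matrix_inv_mult(1)[of "g x"] det[OF that] \<open>d \<noteq> 0\<close>
    by (simp add: vec_eq_iff matrix_matrix_mult_def mat_def inv[OF that] G_def)
  have "(\<Sum>n\<in>UNIV. partial i (K l n) x * G n m x) = - (\<Sum>n\<in>UNIV. K l n x * partial i (G n m) x)"
    if x: "x \<in> U" for i l m x
  proof -
    have "partial i (\<lambda>x. K l 1 x * G 1 m x + K l 2 x * G 2 m x) x = partial i (\<lambda>x. if l = m then 1 else 0 :: real) x"
      using inverse by (intro partial_cong_on_open[OF U x]) (simp add: sum_2)
    then show ?thesis
      using diff_K(1)[OF x] diff_G(1)[OF x] by (simp add: sum_2 partial_add partial_mult)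
  qed
  then have dK_G: "partial i (K l 1) x * G 1 m x + partial i (K l 2) x * G 2 m x
       = - (K l 1 x * partial i (G 1 m) x + K l 2 x * partial i (G 2 m) x)"
    if x: "x \<in> U" for i l m x using that by (simp add: sum_2)
  \<comment> \<open>The derivative of the inverse, \<open>\<partial> K = - K (\<partial> G) K\<close>: multiply \<open>(\<partial> K) G = - K (\<partial> G)\<close> by \<open>K\<close>.\<close>
  have dK: "partial i (K a l) x =
      - (\<Sum>b\<in>UNIV. K a b x * (\<Sum>n\<in>UNIV. K l n x * partial i (G n b) x))" if x: "x \<in> U" for i a l x
  proof -
    have "partial i (K a l) x = (\<Sum>c\<in>UNIV. partial i (K a c) x * (\<Sum>b\<in>UNIV. K l b x * G b c x))"
      unfolding inverse[OF x] by (simp add: if_distrib cong: if_cong)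
    also have "\<dots> = (\<Sum>b\<in>UNIV. K l b x * (partial i (K a 1) x * G 1 b x + partial i (K a 2) x * G 2 b x))"
      using G_sym[of 1 2] by (simp add: sum_2 algebra_simps)
    also have "\<dots> = - (\<Sum>b\<in>UNIV. K a b x * (\<Sum>n\<in>UNIV. K l n x * partial i (G n b) x))"
      unfolding dK_G[OF x] using G_sym[of 1 2] by (simp add: sum_2 algebra_simps)
    finally show ?thesis .
  qed

  have g_diff: "g differentiable at x" if "x \<in> U" for x
    using diff[OF C2 that] by (intro differentiable_vec) simp
  have dg: "partial i g x $ a $ b = partial i (G a b) x" if "x \<in> U" for i a b x
  proof -
    have "(\<lambda>x. g x $ a) differentiable at x"
      using diff[OF C2 that] by (intro differentiable_vec) simp
    then show ?thesis using g_diff[OF that] by (simp add: partial_vec_nth G_def)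
  qed
  \<comment> \<open>Exchanging the differentiation index \<open>b\<close> with the matrix index \<open>m\<close> exhibits the derivative of the
    inverse.\<close>
  have current: "sigma_current g a x = (\<chi> l m. - partial m (K a l) x)" if x: "x \<in> U" for a x
  proof -
    have "sigma_current g a x $ l $ m = (\<Sum>b\<in>UNIV. K a b x * (\<Sum>n\<in>UNIV. K l n x * partial b (G n m) x))" for l m
      by (simp add: sigma_current_def matrix_matrix_mult_def inv[OF x] dg[OF x])
    moreover have "partial b (G n m) x = partial m (G n b) x" for b n m
      using Hess'[OF x, of b m n] G_sym[of n m] G_sym[of n b] by simp
    ultimately show ?thesis by (simp add: vec_eq_iff dK[OF x])
  qed
  define J where "J a x = (\<chi> l m. - partial m (K a l) x)" for a x
  have J_diff': "(\<lambda>x. J a x $ l) differentiable at x" "J a differentiable at x" if "x \<in> U" for a l x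
    using diff_K(2)[OF that] by (auto intro!: differentiable_vec simp: J_def)
  have "sigma_current g a differentiable_on U" for a
  proof -
    have "J a differentiable_on U"
      using J_diff'(2) U by (simp add: differentiable_on_eq_differentiable_at)
    then show ?thesis
      unfolding differentiable_on_def
      by (metis J_def current differentiable_transform_within zero_less_one)
  qed
  moreover have "(\<Sum>a\<in>UNIV. partial a (sigma_current g a) x) = 0" if x: "x \<in> U" for x
  proof -
    have "(\<Sum>a\<in>UNIV. partial a (sigma_current g a) x) $ l $ m = 0" for l m
    proof -
      have "partial a (sigma_current g a) x $ l $ m = - partial m (partial a (K a l)) x" for a
      proof -
        have "partial a (sigma_current g a) x = partial a (J a) x"
          by (rule partial_cong_on_open[OF U x]) (simp add: current J_def)
        also have "\<dots> $ l $ m = partial a (\<lambda>x. - partial m (K a l) x) x"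
          using J_diff'[OF x] by (simp add: partial_vec_nth) (simp add: J_def)
        also have "\<dots> = - partial m (partial a (K a l)) x"
          by (simp add: partial_uminus diff_K[OF x] partial_commute[OF U x K, of a m])
        finally show ?thesis .
      qed
      then have "(\<Sum>a\<in>UNIV. partial a (sigma_current g a) x) $ l $ m
          = - partial m (\<lambda>x. \<Sum>a\<in>UNIV. partial a (K a l) x) x"
        by (simp add: sum_2 partial_add diff_K[OF x])
      also have "partial m (\<lambda>x. \<Sum>a\<in>UNIV. partial a (K a l) x) x = partial m (\<lambda>x. 0 :: real) x"
        by (rule partial_cong_on_open[OF U x]) (rule div_K)
      finally show ?thesis by simp
    qed
    then show ?thesis by (simp add: vec_eq_iff)
  qed
  ultimately show ?thesis
    using g_diff U by (simp add: sigma_model_on_def differentiable_on_eq_differentiable_at)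
qed

section \<open>The conformal metric of a minimal graph is Hessian\<close>

text \<open>The algebraic core of the minimal surface computation. The difference of the two sides is
  antisymmetric in \<open>a\<close> and \<open>b\<close>, and for \<open>a \<noteq> b\<close> it is, up to sign, a component of \<open>P\<close> times the
  trace of \<open>F\<close> with respect to the cofactors of \<open>h\<close>. It is applied with \<open>F\<close> the second derivatives of
  \<open>\<phi>\<close>, whose trace vanishes with the mean curvature, and with \<open>P\<close> the gradient of \<open>\<phi>\<close>.\<close>

lemma trace_free_contraction:
  fixes h F :: "2 \<Rightarrow> 2 \<Rightarrow> real" and p P :: "2 \<Rightarrow> real"
  assumes h: "h 2 1 = h 1 2" and F: "F 2 1 = F 1 2"
    and trace: "h 2 2 * F 1 1 - 2 * h 1 2 * F 1 2 + h 1 1 * F 2 2 = 0"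
    and P: "\<And>a. r * p a = (\<Sum>b\<in>UNIV. h a b * P b)"
  shows "r * (p b * F a c - p a * F b c)
    = h b c * (\<Sum>m\<in>UNIV. P m * F m a) - h a c * (\<Sum>m\<in>UNIV. P m * F m b)"
proof -
  have "r * (p b * F a c - p a * F b c) = (r * p b) * F a c - (r * p a) * F b c"
    by (simp add: algebra_simps)
  also have "\<dots> = h b c * (\<Sum>m\<in>UNIV. P m * F m a) - h a c * (\<Sum>m\<in>UNIV. P m * F m b)"
    unfolding P using arg_cong[OF trace, of "\<lambda>t. P 1 * t"] arg_cong[OF trace, of "\<lambda>t. P 2 * t"]
      exhaust_2[of a] exhaust_2[of b] exhaust_2[of c]
    by (elim disjE) (simp_all add: sum_2 h F algebra_simps)
  finally show ?thesis .
qed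

definition raised_gradient :: "real ^ 2 ^ 2 \<Rightarrow> (real ^ 2 \<Rightarrow> real) \<Rightarrow> 2 \<Rightarrow> real ^ 2 \<Rightarrow> real"
  where "raised_gradient g0 \<phi> \<mu> x = (\<Sum>\<nu>\<in>UNIV. matrix_inv g0 $ \<mu> $ \<nu> * partial \<nu> \<phi> x)"

lemma rho_eq_gradient:
  "rho e g0 \<phi> x = 1 + e * (\<Sum>\<mu>\<in>UNIV. raised_gradient g0 \<phi> \<mu> x * partial \<mu> \<phi> x)"
  by (simp add: rho_def raised_gradient_def sum_2 algebra_simps)

lemma induced_metric_sym:
  assumes "transpose g0 = g0"
  shows "induced_metric e g0 \<phi> x $ a $ b = induced_metric e g0 \<phi> x $ b $ a"
proof -
  have "g0 $ a $ b = g0 $ b $ a"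
    by (subst assms[symmetric]) (simp add: transpose_def)
  then show ?thesis by (simp add: induced_metric_def algebra_simps)
qed

text \<open>The gradient of \<open>\<phi>\<close> for \<open>g\<^sub>0\<close>, lowered with \<open>h\<close> in place of \<open>g\<^sub>0\<close>, is multiplied by \<open>\<rho>\<close>: the extra
  term \<open>\<epsilon> \<phi>\<^sub>a \<phi>\<^sub>b\<close> of \<open>h\<close> contributes \<open>\<phi>\<^sub>a (\<rho> - 1)\<close>.\<close>

lemma induced_metric_gradient:
  assumes "invertible g0"
  shows "rho e g0 \<phi> x * partial a \<phi> x = (\<Sum>b\<in>UNIV. induced_metric e g0 \<phi> x $ a $ b * raised_gradient g0 \<phi> b x)"
proof -
  have "det g0 \<noteq> 0" using assms by (simp add: invertible_det_nz)
  have "raised_gradient g0 \<phi> b x = (matrix_inv g0 *v (\<chi> c. partial c \<phi> x)) $ b" for b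
    by (simp add: raised_gradient_def matrix_vector_mult_def)
  then have "(\<Sum>b\<in>UNIV. g0 $ a $ b * raised_gradient g0 \<phi> b x) = (g0 *v (matrix_inv g0 *v (\<chi> c. partial c \<phi> x))) $ a"
    by (simp add: matrix_vector_mult_def)
  also have "\<dots> = partial a \<phi> x"
    by (simp add: matrix_vector_mul_assoc matrix_inv_mult[OF \<open>det g0 \<noteq> 0\<close>])
  finally show ?thesis
    by (simp add: rho_eq_gradient induced_metric_def sum_2 algebra_simps)
qed

lemma det_induced_metric:
  assumes "transpose g0 = g0" "invertible g0"
  shows "det (induced_metric e g0 \<phi> x) = rho e g0 \<phi> x * det g0"
proof -
  have nz: "det g0 \<noteq> 0" using assms by (simp add: invertible_det_nz)
  have sym: "g0 $ 2 $ 1 = g0 $ 1 $ 2"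
    by (subst assms(1)[symmetric]) (simp add: transpose_def)
  have "rho e g0 \<phi> x * det g0 = det g0 + e *
     (g0 $ 2 $ 2 * partial 1 \<phi> x * partial 1 \<phi> x - 2 * g0 $ 1 $ 2 * partial 1 \<phi> x * partial 2 \<phi> x
      + g0 $ 1 $ 1 * partial 2 \<phi> x * partial 2 \<phi> x)"
    using nz by (simp add: rho_def sum_2 matrix_inv_2[OF nz] sym field_simps)
  then show ?thesis
    by (simp add: det_2 induced_metric_def sym algebra_simps)
qed

lemma conformal_metric_eq:
  "conformal_metric e g0 \<phi> x $ a $ b = induced_metric e g0 \<phi> x $ a $ b * inverse (sqrt (rho e g0 \<phi> x))"
  by (simp add: conformal_metric_def divide_inverse)

lemma det_conformal_metric:
  assumes "transpose g0 = g0" "invertible g0" "rho e g0 \<phi> x > 0"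
  shows "det (conformal_metric e g0 \<phi> x) = det g0"
proof -
  let ?w = "inverse (sqrt (rho e g0 \<phi> x))"
  have "det (conformal_metric e g0 \<phi> x) = (?w * ?w) * det (induced_metric e g0 \<phi> x)"
    by (simp add: det_2 conformal_metric_eq algebra_simps)
  also have "?w * ?w = 1 / rho e g0 \<phi> x"
    using assms(3) by (simp add: field_simps)
  finally show ?thesis using assms by (simp add: det_induced_metric)
qed

text \<open>Clearing the denominators \<open>sqrt \<rho>\<close> and \<open>det h\<close> turns \<open>H = 0\<close> into a trace condition that is
  polynomial in the derivatives of \<open>\<phi>\<close>.\<close>

lemma mean_curvature_zero_cofactor:
  assumes "transpose g0 = g0" "invertible g0" "rho e g0 \<phi> x > 0" "mean_curvature e g0 \<phi> x = 0"
    and sym: "partial 2 (partial 1 \<phi>) x = partial 1 (partial 2 \<phi>) x"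
  shows "induced_metric e g0 \<phi> x $ 2 $ 2 * partial 1 (partial 1 \<phi>) x
    - 2 * induced_metric e g0 \<phi> x $ 1 $ 2 * partial 2 (partial 1 \<phi>) x
    + induced_metric e g0 \<phi> x $ 1 $ 1 * partial 2 (partial 2 \<phi>) x = 0"
    (is "?X = 0")
proof -
  have nz: "det (induced_metric e g0 \<phi> x) \<noteq> 0"
    using assms by (simp add: det_induced_metric flip: invertible_det_nz)
  have "(\<Sum>\<mu>\<in>UNIV. \<Sum>\<nu>\<in>UNIV.
        matrix_inv (induced_metric e g0 \<phi> x) $ \<mu> $ \<nu> * partial \<nu> (partial \<mu> \<phi>) x) = 0"
    using assms(3,4) by (simp add: mean_curvature_def)
  then have "?X / det (induced_metric e g0 \<phi> x) = 0"
    by (simp add: sum_2 matrix_inv_2[OF nz] induced_metric_sym[OF assms(1), of e \<phi> x 2 1] sym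
        add_divide_distrib diff_divide_distrib algebra_simps)
  then show ?thesis using nz by simp
qed

context
  fixes U :: "(real ^ 2) set" and \<phi> :: "real ^ 2 \<Rightarrow> real" and g0 :: "real ^ 2 ^ 2" and e :: real
  assumes U: "open U" and \<phi>: "smooth_on U \<phi>"
begin

lemma Ck_on_partial: "Ck_on k U (partial a \<phi>)"
  using \<phi> by (metis Ck_on.simps(2) smooth_on_def)

lemma Ck_on_induced_metric: "Ck_on k U (\<lambda>x. induced_metric e g0 \<phi> x $ a $ b)"
  unfolding induced_metric_def by (simp, intro Ck_on_add[OF U] Ck_on_mult[OF U] Ck_on_const Ck_on_partial)

lemma Ck_on_rho: "Ck_on k U (rho e g0 \<phi>)"
proof -
  have "rho e g0 \<phi> = (\<lambda>x. 1 + e *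
    ((matrix_inv g0 $ 1 $ 1 * partial 1 \<phi> x * partial 1 \<phi> x + matrix_inv g0 $ 1 $ 2 * partial 1 \<phi> x * partial 2 \<phi> x)
    + (matrix_inv g0 $ 2 $ 1 * partial 2 \<phi> x * partial 1 \<phi> x + matrix_inv g0 $ 2 $ 2 * partial 2 \<phi> x * partial 2 \<phi> x)))"
    by (simp add: fun_eq_iff rho_def sum_2)
  then show ?thesis
    by (simp only:) (intro Ck_on_add[OF U] Ck_on_mult[OF U] Ck_on_const Ck_on_partial)
qed

lemma Ck_on_conformal_metric:
  assumes "\<And>x. x \<in> U \<Longrightarrow> rho e g0 \<phi> x > 0"
  shows "Ck_on k U (\<lambda>x. conformal_metric e g0 \<phi> x $ a $ b)"
  unfolding conformal_metric_eq
  by (intro Ck_on_mult[OF U] Ck_on_induced_metric Ck_on_inverse_sqrt[OF U] Ck_on_rho assms)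

lemma partial_induced_metric:
  assumes "x \<in> U"
  shows "partial c (\<lambda>x. induced_metric e g0 \<phi> x $ a $ b) x =
    e * (partial c (partial a \<phi>) x * partial b \<phi> x + partial a \<phi> x * partial c (partial b \<phi>) x)"
  using Ck_on_differentiable_at[OF U Ck_on_partial assms]
  by (simp add: induced_metric_def partial_add partial_mult algebra_simps)

lemma partial_rho:
  assumes x: "x \<in> U" and "transpose g0 = g0" "invertible g0"
  shows "partial c (rho e g0 \<phi>) x = 2 * e * (\<Sum>m\<in>UNIV. raised_gradient g0 \<phi> m x * partial c (partial m \<phi>) x)"
proof -
  let ?K = "matrix_inv g0"
  have nz: "det g0 \<noteq> 0" using assms by (simp add: invertible_det_nz)
  have "g0 $ 2 $ 1 = g0 $ 1 $ 2"
    by (subst assms(2)[symmetric]) (simp add: transpose_def)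
  then have sym: "?K $ 2 $ 1 = ?K $ 1 $ 2" by (simp add: matrix_inv_2[OF nz])
  have rho: "rho e g0 \<phi> = (\<lambda>x. 1 + e * (?K $ 1 $ 1 * (partial 1 \<phi> x * partial 1 \<phi> x)
     + (2 * ?K $ 1 $ 2 * (partial 1 \<phi> x * partial 2 \<phi> x) + ?K $ 2 $ 2 * (partial 2 \<phi> x * partial 2 \<phi> x))))"
    by (simp add: fun_eq_iff rho_def sum_2 sym algebra_simps)
  show ?thesis
    unfolding rho using Ck_on_differentiable_at[OF U Ck_on_partial x]
    by (simp add: partial_add partial_mult raised_gradient_def sum_2 sym algebra_simps)
qed

text \<open>Both sides are computed from \<open>g = h \<rho>\<^sup>-\<^sup>1\<^sup>/\<^sup>2\<close>. In the difference the terms from differentiating \<open>h\<close>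
  and those from differentiating \<open>\<rho>\<close> cancel by \<open>trace_free_contraction\<close>.\<close>

lemma minimal_conformal_metric_Hessian:
  assumes g0: "transpose g0 = g0" "invertible g0"
    and pos: "\<And>x. x \<in> U \<Longrightarrow> rho e g0 \<phi> x > 0"
    and H: "\<And>x. x \<in> U \<Longrightarrow> mean_curvature e g0 \<phi> x = 0"
    and x: "x \<in> U"
  shows "partial a (\<lambda>x. conformal_metric e g0 \<phi> x $ b $ c) x
    = partial b (\<lambda>x. conformal_metric e g0 \<phi> x $ a $ c) x"
proof -
  define h where "h a b = induced_metric e g0 \<phi> x $ a $ b" for a b
  define p where "p a = partial a \<phi> x" for a
  define P where "P a = raised_gradient g0 \<phi> a x" for a
  define F where "F a b = partial b (partial a \<phi>) x" for a b
  define r where "r = rho e g0 \<phi> x"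
  define w where "w = inverse (sqrt r)"
  have F_sym: "F a b = F b a" for a b
    using \<phi> by (simp add: F_def smooth_on_def partial_commute[OF U x])
  have r: "r > 0" using pos[OF x] by (simp add: r_def)
  have w: "w ^ 3 * r = w"
    using r by (simp add: w_def power3_eq_cube field_simps)
  have trace: "h 2 2 * F 1 1 - 2 * h 1 2 * F 1 2 + h 1 1 * F 2 2 = 0"
    unfolding h_def F_def
    by (rule mean_curvature_zero_cofactor[OF g0 pos[OF x] H[OF x]])
      (use F_sym[of 1 2] in \<open>simp add: F_def\<close>)
  have h_sym: "h 2 1 = h 1 2"
    unfolding h_def by (rule induced_metric_sym[OF g0(1)])
  have "r * p a = (\<Sum>b\<in>UNIV. h a b * P b)" for a
    unfolding r_def p_def h_def P_def by (rule induced_metric_gradient[OF g0(2)])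
  note key = trace_free_contraction[OF h_sym F_sym trace this]
  have d: "partial i (\<lambda>x. conformal_metric e g0 \<phi> x $ k $ l) x =
      e * (w * (F k i * p l + p k * F l i) - w ^ 3 * (h k l * (\<Sum>m\<in>UNIV. P m * F m i)))" for i k l
  proof -
    have "rho e g0 \<phi> differentiable at x" "(\<lambda>x. induced_metric e g0 \<phi> x $ k $ l) differentiable at x"
      by (rule Ck_on_differentiable_at[OF U _ x], rule Ck_on_rho Ck_on_induced_metric)+
    moreover have "(\<lambda>x. inverse (sqrt (rho e g0 \<phi> x))) differentiable at x"
      by (rule Ck_on_differentiable_at[OF U Ck_on_inverse_sqrt[OF U pos Ck_on_rho] x])
    ultimately show ?thesis
      unfolding conformal_metric_eq r_def h_def p_def P_def F_def w_def
      by (simp add: partial_mult partial_inverse_sqrt pos[OF x] partial_induced_metric[OF x]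
          partial_rho[OF x g0] algebra_simps)
  qed
  have "partial a (\<lambda>x. conformal_metric e g0 \<phi> x $ b $ c) x - partial b (\<lambda>x. conformal_metric e g0 \<phi> x $ a $ c) x
    = e * (w * (p b * F a c - p a * F b c)
      - w ^ 3 * (h b c * (\<Sum>m\<in>UNIV. P m * F m a) - h a c * (\<Sum>m\<in>UNIV. P m * F m b)))"
    unfolding d F_sym[of c] F_sym[of b a] by (simp add: algebra_simps)
  also have "\<dots> = e * ((w - w ^ 3 * r) * (p b * F a c - p a * F b c))"
    unfolding key[symmetric] by (simp add: algebra_simps)
  also have "\<dots> = 0" by (simp add: w)
  finally show ?thesis by simp
qed

end

theorem proposition3:
  fixes e :: real and g0 :: "real ^ 2 ^ 2"
    and \<phi> :: "real ^ 2 \<Rightarrow> real" and U :: "(real ^ 2) set"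
  assumes "e \<in> {1, -1}"
    and "transpose g0 = g0" and "invertible g0"
    and "open U" and "smooth_on U \<phi>"
    and "\<forall>x\<in>U. rho e g0 \<phi> x > 0"
    and "\<forall>x\<in>U. mean_curvature e g0 \<phi> x = 0"
  shows "sigma_model_on U (conformal_metric e g0 \<phi>)"
proof (rule unimodular_Hessian_metric_sigma_model[OF \<open>open U\<close>])
  show "Ck_on 2 U (\<lambda>x. conformal_metric e g0 \<phi> x $ a $ b)" for a b
    using assms by (intro Ck_on_conformal_metric) auto
  show "conformal_metric e g0 \<phi> x $ a $ b = conformal_metric e g0 \<phi> x $ b $ a" for x a b
    using assms(2) by (simp add: conformal_metric_eq induced_metric_sym[of g0 e \<phi> x a b])
  show "det (conformal_metric e g0 \<phi> x) = det g0" if "x \<in> U" for x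
    using assms that by (intro det_conformal_metric) auto
  show "det g0 \<noteq> 0" using assms(3) by (simp add: invertible_det_nz)
  show "partial a (\<lambda>x. conformal_metric e g0 \<phi> x $ b $ c) x
      = partial b (\<lambda>x. conformal_metric e g0 \<phi> x $ a $ c) x" if "x \<in> U" for x a b c
    using assms that by (intro minimal_conformal_metric_Hessian[of U]) auto
qed

end
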